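(* Let $C$ be a switching class of tournaments on a finite set $V$ with $|V|=r$, and let $n>r$. Let $R$ be a random tournament on $n$ vertices (each edge oriented independently and uniformly at random). Then the expected number of $r$-subsets $W$ of the vertex set of $R$ such that the subtournament of $R$ induced on $W$ is isomorphic to a tournament in $C$ equals $$\binom{n}{r}\cdot\frac{|\operatorname{Sym}(V):\operatorname{Aut}(C)|}{2^{\binom{r-1}{2}}}.$$
   Context: A tournament $T$ on $V$ is identified with the antisymmetric function $e_T$ on ordered pairs of distinct vertices with values $\pm1$, $e_T(x,y)=1$ iff $(x,y)$ is an edge; $g_T(x,y,z)=e_T(x,y)e_T(y,z)e_T(z,x)$. For $X\subseteq V$, $T^X$ reverses all edges between $X$ and $V\setminus X$; $T_1,T_2$ are switching equivalent if $T_2=T_1^X$ for some $X$, and switching classes are the equivalence classes. All tournaments in a switching class $C$ share the same $g_T=:g$, and $\operatorname{Aut}(C)$ is the group of permutations $\sigma$ of $V$ with $g(\sigma(x),\sigma(y),\sigma(z))=g(x,y,z)$ for all distinct $x,y,z$; $|\operatorname{Sym}(V):\operatorname{Aut}(C)|$ denotes the index in the symmetric group on $V$. *)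

theory Defs
  imports "HOL-Algebra.Bij" "HOL-Algebra.Coset" "HOL-Probability.Product_PMF"
begin

section \<open>Tournaments and switching\<close>

text \<open>A tournament on \<open>V\<close> is given by its set of directed edges. The antisymmetric
  function on ordered pairs of distinct vertices identified with it is \<open>tourn_sign\<close>.\<close>

definition tournaments :: "'a set \<Rightarrow> ('a \<times> 'a) set set" where
  "tournaments V = {T. T \<subseteq> V \<times> V \<and> irrefl T \<and>
     (\<forall>x\<in>V. \<forall>y\<in>V. x \<noteq> y \<longrightarrow> ((x, y) \<in> T \<longleftrightarrow> (y, x) \<notin> T))}"

definition tourn_sign :: "('a \<times> 'a) set \<Rightarrow> 'a \<Rightarrow> 'a \<Rightarrow> int" where
  "tourn_sign T x y = (if (x, y) \<in> T then 1 else - 1)"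

definition tourn_triple :: "('a \<times> 'a) set \<Rightarrow> 'a \<Rightarrow> 'a \<Rightarrow> 'a \<Rightarrow> int" where
  "tourn_triple T x y z = tourn_sign T x y * tourn_sign T y z * tourn_sign T z x"

text \<open>For \<open>X \<subseteq> V\<close>, an edge lies between \<open>X\<close> and \<open>V - X\<close> iff exactly one of its ends is in \<open>X\<close>.\<close>

definition switch :: "'a set \<Rightarrow> ('a \<times> 'a) set \<Rightarrow> ('a \<times> 'a) set" where
  "switch X T = {(x, y). if x \<in> X \<longleftrightarrow> y \<in> X then (x, y) \<in> T else (y, x) \<in> T}"

definition switching :: "'a set \<Rightarrow> (('a \<times> 'a) set \<times> ('a \<times> 'a) set) set" where
  "switching V = {(T\<^sub>1, T\<^sub>2). T\<^sub>1 \<in> tournaments V \<and> T\<^sub>2 \<in> tournaments V \<and>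
     (\<exists>X\<subseteq>V. T\<^sub>2 = switch X T\<^sub>1)}"

definition switching_classes :: "'a set \<Rightarrow> ('a \<times> 'a) set set set" where
  "switching_classes V = tournaments V // switching V"

lemma equiv_switching: "equiv (tournaments V) (switching V)"
proof (rule equivI)
  show "switching V \<subseteq> tournaments V \<times> tournaments V"
    by (auto simp: switching_def)
  have "switch {} T = T" for T :: "('a \<times> 'a) set"
    by (auto simp: switch_def)
  then show "refl_on (tournaments V) (switching V)"
    unfolding refl_on_def switching_def by (force intro: exI[of _ "{}"])
  have "switch X (switch X T) = T" for X and T :: "('a \<times> 'a) set"
    by (auto simp: switch_def)
  then show "sym (switching V)"
    by (intro symI) (auto simp: switching_def)
  have *: "switch Y (switch X T) = switch ((X - Y) \<union> (Y - X)) T" for X Y and T :: "('a \<times> 'a) set"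
    by (auto simp: switch_def split: if_splits)
  show "trans (switching V)"
  proof (rule transI)
    fix S T U assume "(S, T) \<in> switching V" "(T, U) \<in> switching V"
    then obtain X Y where "S \<in> tournaments V" "U \<in> tournaments V" "X \<subseteq> V" "Y \<subseteq> V"
        "U = switch Y (switch X S)"
      by (auto simp: switching_def)
    moreover have "(X - Y) \<union> (Y - X) \<subseteq> V" using \<open>X \<subseteq> V\<close> \<open>Y \<subseteq> V\<close> by blast
    ultimately show "(S, U) \<in> switching V"
      unfolding switching_def using *[of Y X S] by blast
  qed
qed

lemma tourn_triple_switching:
  assumes "(S, T) \<in> switching V" "{x, y, z} \<subseteq> V" "distinct [x, y, z]"
  shows "tourn_triple T x y z = tourn_triple S x y z"
proof -
  obtain X where S: "S \<in> tournaments V" and T: "T = switch X S"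
    using assms(1) by (auto simp: switching_def)
  have sign: "tourn_sign T a b = (if a \<in> X \<longleftrightarrow> b \<in> X then 1 else - 1) * tourn_sign S a b"
    if "a \<in> V" "b \<in> V" "a \<noteq> b" for a b
  proof -
    have "(a, b) \<in> S \<longleftrightarrow> (b, a) \<notin> S" using S that unfolding tournaments_def by blast
    then show ?thesis unfolding T tourn_sign_def switch_def by auto
  qed
  show ?thesis
    using assms(2,3) sign[of x y] sign[of y z] sign[of z x] unfolding tourn_triple_def by auto
qed

section \<open>Automorphisms and isomorphisms\<close>

text \<open>By the preceding lemma all tournaments in a switching class have the same
  \<open>tourn_triple\<close> on distinct vertices, so quantifying over \<open>T \<in> C\<close> amounts to
  fixing any one representative. The group \<open>Sym(V)\<close> is \<^term>\<open>BijGroup V\<close>.\<close>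

definition class_aut :: "'a set \<Rightarrow> ('a \<times> 'a) set set \<Rightarrow> ('a \<Rightarrow> 'a) set" where
  "class_aut V C = {\<sigma> \<in> carrier (BijGroup V).
     \<forall>T\<in>C. \<forall>x\<in>V. \<forall>y\<in>V. \<forall>z\<in>V. distinct [x, y, z] \<longrightarrow>
       tourn_triple T (\<sigma> x) (\<sigma> y) (\<sigma> z) = tourn_triple T x y z}"

lemma subgroup_class_aut: "subgroup (class_aut V C) (BijGroup V)"
proof -
  interpret group "BijGroup V" by (rule group_BijGroup)
  have carr: "carrier (BijGroup V) = Bij V" by (simp add: BijGroup_def)
  have inV: "\<sigma> x \<in> V" if "\<sigma> \<in> Bij V" "x \<in> V" for \<sigma> x
    using that by (auto simp: Bij_def bij_betw_def)
  have neq: "\<sigma> x = \<sigma> y \<longleftrightarrow> x = y" if "\<sigma> \<in> Bij V" "x \<in> V" "y \<in> V" for \<sigma> x y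
    using that by (auto simp: Bij_def bij_betw_def inj_on_eq_iff)
  show ?thesis
  proof (rule subgroupI)
    show "class_aut V C \<subseteq> carrier (BijGroup V)" by (auto simp: class_aut_def)
    have "\<one>\<^bsub>BijGroup V\<^esub> \<in> class_aut V C"
      using id_Bij[of V] by (auto simp: class_aut_def BijGroup_def)
    then show "class_aut V C \<noteq> {}" by blast
  next
    fix \<sigma> assume s: "\<sigma> \<in> class_aut V C"
    then have B: "\<sigma> \<in> Bij V" by (simp add: class_aut_def carr)
    let ?\<tau> = "\<lambda>x\<in>V. inv_into V \<sigma> x"
    have "inv\<^bsub>BijGroup V\<^esub> \<sigma> = ?\<tau>" using inv_BijGroup[OF B] .
    moreover have "?\<tau> \<in> class_aut V C"
    proof -
      have T: "?\<tau> \<in> Bij V" by (rule restrict_inv_into_Bij[OF B])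
      have st: "\<sigma> (?\<tau> x) = x" if "x \<in> V" for x
        using B that by (simp add: Bij_def bij_betw_def f_inv_into_f)
      show ?thesis unfolding class_aut_def carr
      proof (intro CollectI conjI T ballI impI)
        fix T x y z assume *: "T \<in> C" "x \<in> V" "y \<in> V" "z \<in> V" "distinct [x, y, z]"
        have "distinct [?\<tau> x, ?\<tau> y, ?\<tau> z]" using neq[OF T] * by (simp del: restrict_apply)
        then have "tourn_triple T (\<sigma> (?\<tau> x)) (\<sigma> (?\<tau> y)) (\<sigma> (?\<tau> z))
            = tourn_triple T (?\<tau> x) (?\<tau> y) (?\<tau> z)"
          using s * inV[OF T] unfolding class_aut_def by blast
        then show "tourn_triple T (?\<tau> x) (?\<tau> y) (?\<tau> z) = tourn_triple T x y z"
          using * by (simp only: st)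
      qed
    qed
    ultimately show "inv\<^bsub>BijGroup V\<^esub> \<sigma> \<in> class_aut V C" by simp
  next
    fix \<sigma> \<tau> assume *: "\<sigma> \<in> class_aut V C" "\<tau> \<in> class_aut V C"
    then have B: "\<sigma> \<in> Bij V" "\<tau> \<in> Bij V" by (auto simp: class_aut_def carr)
    have "\<sigma> \<otimes>\<^bsub>BijGroup V\<^esub> \<tau> = compose V \<sigma> \<tau>" using B by (simp add: BijGroup_def)
    moreover have "compose V \<sigma> \<tau> \<in> class_aut V C"
      using * compose_Bij[OF B] inV[OF B(2)] neq[OF B(2)]
      by (simp add: class_aut_def carr compose_eq)
    ultimately show "\<sigma> \<otimes>\<^bsub>BijGroup V\<^esub> \<tau> \<in> class_aut V C" by simp
  qed
qed

definition tourn_iso :: "'a set \<Rightarrow> ('a \<times> 'a) set \<Rightarrow> 'b set \<Rightarrow> ('b \<times> 'b) set \<Rightarrow> bool" where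
  "tourn_iso V T W S \<longleftrightarrow>
     (\<exists>f. bij_betw f V W \<and> (\<forall>x\<in>V. \<forall>y\<in>V. (x, y) \<in> T \<longleftrightarrow> (f x, f y) \<in> S))"

definition induced :: "('b \<times> 'b) set \<Rightarrow> 'b set \<Rightarrow> ('b \<times> 'b) set" where
  "induced R W = R \<inter> W \<times> W"

section \<open>Random tournaments\<close>

text \<open>Independently for every unordered pair \<open>e = {x, y}\<close> of distinct vertices, one of the two
  orientations \<open>(x, y)\<close>, \<open>(y, x)\<close> of \<open>e\<close> is chosen uniformly; the edge set
  of the tournament consists of the chosen orientations.\<close>

definition random_tournament :: "'b set \<Rightarrow> ('b \<times> 'b) set pmf" where
  "random_tournament U =
     (let P = {e. e \<subseteq> U \<and> card e = 2}
      in map_pmf (\<lambda>\<omega>. \<omega> ` P) (Pi_pmf P undefined (\<lambda>e. pmf_of_set {(x, y). {x, y} = e})))"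

lemma set_pmf_random_tournament:
  assumes "finite U"
  shows "set_pmf (random_tournament U) \<subseteq> tournaments U"
proof
  let ?P = "{e. e \<subseteq> U \<and> card e = 2}"
  fix R assume R: "R \<in> set_pmf (random_tournament U)"
  have fin: "finite ?P" using assms by simp
  have orient: "finite {(x, y). {x, y} = e}" "{(x, y). {x, y} = e} \<noteq> {}" if "e \<in> ?P" for e
  proof -
    obtain a b where "e = {a, b}" using \<open>e \<in> ?P\<close> by (auto simp: card_2_iff)
    then have "{(x, y). {x, y} = e} = {(a, b), (b, a)}" by (auto simp: doubleton_eq_iff)
    then show "finite {(x, y). {x, y} = e}" "{(x, y). {x, y} = e} \<noteq> {}" by simp_all
  qed
  obtain \<omega> where R_eq: "R = \<omega> ` ?P"
      and \<omega>: "\<omega> \<in> set_pmf (Pi_pmf ?P undefined (\<lambda>e. pmf_of_set {(x, y). {x, y} = e}))"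
    using R unfolding random_tournament_def Let_def by auto
  have mem: "{x, y} = e" if "e \<in> ?P" "\<omega> e = (x, y)" for e x y
  proof -
    have "\<omega> e \<in> set_pmf (pmf_of_set {(x, y). {x, y} = e})"
      using \<omega> \<open>e \<in> ?P\<close> unfolding set_Pi_pmf[OF fin] PiE_dflt_def by auto
    then have "\<omega> e \<in> {(x, y). {x, y} = e}"
      by (simp only: set_pmf_of_set[OF orient(2,1)[OF \<open>e \<in> ?P\<close>]])
    then show ?thesis by (simp only: \<open>\<omega> e = (x, y)\<close> mem_Collect_eq prod.case)
  qed
  have edge: "(x, y) \<in> R \<longleftrightarrow> {x, y} \<in> ?P \<and> \<omega> {x, y} = (x, y)" for x y
  proof
    assume "(x, y) \<in> R"
    then obtain e where e: "e \<in> ?P" "\<omega> e = (x, y)" unfolding R_eq by force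
    then show "{x, y} \<in> ?P \<and> \<omega> {x, y} = (x, y)" by (simp only: mem[OF e])
  next
    assume "{x, y} \<in> ?P \<and> \<omega> {x, y} = (x, y)"
    then show "(x, y) \<in> R" unfolding R_eq by (metis imageI)
  qed
  show "R \<in> tournaments U"
    unfolding tournaments_def
  proof (intro CollectI conjI ballI impI)
    show "R \<subseteq> U \<times> U" using edge by auto
    show "irrefl R" unfolding irrefl_def edge by simp
    fix x y assume "x \<in> U" "y \<in> U" "x \<noteq> y"
    then have P: "{x, y} \<in> ?P" by simp
    obtain a b where ab: "\<omega> {x, y} = (a, b)" by fastforce
    have "a = x \<and> b = y \<or> a = y \<and> b = x"
      using mem[OF P ab] by (simp only: doubleton_eq_iff)
    with P ab \<open>x \<noteq> y\<close> show "(x, y) \<in> R \<longleftrightarrow> (y, x) \<notin> R"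
      unfolding edge insert_commute[of y x] by auto
  qed
qed

end

(* Restricted to an r-set W, the random tournament is uniform among the 2^(r choose 2) tournaments
   on W, so the expectation is (n choose r) times the proportion of those isomorphic to a member
   of C. The tournaments on V isomorphic to a member of C are the disjoint union of the images of
   C under Sym(V); each image is a switching class of size 2^(r-1). Since g determines the
   switching class, the stabiliser of C is Aut(C), so the number of images is its index. Finally
   (r choose 2) - (r - 1) = (r - 1) choose 2. *)

theory Submission
  imports Defs
begin

section \<open>The uniform distribution on tournaments\<close>

lemma tournaments_subset: "T \<in> tournaments V \<Longrightarrow> T \<subseteq> V \<times> V"
  unfolding tournaments_def by blast

lemma finite_tournaments: "finite V \<Longrightarrow> finite (tournaments V)"
  by (rule finite_subset[of _ "Pow (V \<times> V)"]) (auto dest: tournaments_subset)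

lemma tournaments_irrefl: "T \<in> tournaments V \<Longrightarrow> (x, x) \<notin> T"
  unfolding tournaments_def irrefl_def by blast

lemma tournaments_total:
  "T \<in> tournaments V \<Longrightarrow> x \<in> V \<Longrightarrow> y \<in> V \<Longrightarrow> x \<noteq> y \<Longrightarrow> (x, y) \<in> T \<longleftrightarrow> (y, x) \<notin> T"
  unfolding tournaments_def by blast

lemma tournamentsI:
  assumes "T \<subseteq> V \<times> V" "\<And>x. (x, x) \<notin> T"
    and "\<And>x y. x \<in> V \<Longrightarrow> y \<in> V \<Longrightarrow> x \<noteq> y \<Longrightarrow> (x, y) \<in> T \<longleftrightarrow> (y, x) \<notin> T"
  shows "T \<in> tournaments V"
  unfolding tournaments_def irrefl_def using assms by blast

lemma tournaments_eqI:
  assumes "S \<in> tournaments V" "T \<in> tournaments V"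
    and "\<And>x y. x \<in> V \<Longrightarrow> y \<in> V \<Longrightarrow> x \<noteq> y \<Longrightarrow> (x, y) \<in> S \<longleftrightarrow> (x, y) \<in> T"
  shows "S = T"
proof -
  have "(x, y) \<in> S \<longleftrightarrow> (x, y) \<in> T" for x y
    using assms(3)[of x y] tournaments_subset[OF assms(1)] tournaments_subset[OF assms(2)]
      tournaments_irrefl[OF assms(1), of x] tournaments_irrefl[OF assms(2), of x]
    by auto
  then show ?thesis by auto
qed

text \<open>This is the set that appears verbatim in \<open>random_tournament\<close>, named as a
  function of \<open>e\<close> so that the facts about products of uniform distributions apply to
  it.\<close>

definition orientations :: "'a set \<Rightarrow> ('a \<times> 'a) set" where
  "orientations e = {(x, y). {x, y} = e}"

lemma orientations_card2:
  assumes "card e = 2"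
  shows "finite (orientations e)" "card (orientations e) = 2"
proof -
  obtain a b where e: "e = {a, b}" "a \<noteq> b" using assms by (auto simp: card_2_iff)
  then have "orientations e = {(a, b), (b, a)}"
    by (auto simp: orientations_def doubleton_eq_iff)
  then show "finite (orientations e)" "card (orientations e) = 2" using e by auto
qed

text \<open>Independent uniform choices are uniform on the product of the sets of orientations, and
  taking the set of chosen orientations is a bijection from that product onto the tournaments on
  \<open>U\<close>. The product has one factor of size 2 per unordered pair, which also gives the
  count.\<close>

lemma random_tournament_uniform:
  assumes "finite U"
  shows "random_tournament U = pmf_of_set (tournaments U)"
    and "card (tournaments U) = 2 ^ (card U choose 2)"
proof -
  let ?P = "{e. e \<subseteq> U \<and> card e = 2}"
  let ?D = "PiE_dflt ?P undefined orientations"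
  have fin: "finite ?P" using assms by simp
  have ori: "finite (orientations e)" "orientations e \<noteq> {}" "card (orientations e) = 2"
    if "e \<in> ?P" for e :: "'a set"
    using orientations_card2[of e] that by auto
  have finD: "finite ?D" using fin ori by (intro finite_PiE_dflt)
  have "card ?D = (\<Prod>e\<in>?P. card (orientations e))"
    by (rule card_PiE_dflt[OF fin ori(1)])
  also have "\<dots> = (\<Prod>e\<in>?P. 2)" by (rule prod.cong[OF refl ori(3)])
  finally have cardD: "card ?D = 2 ^ (card U choose 2)"
    using assms by (simp add: n_subsets)
  then have D: "?D \<noteq> {}" by (metis card.empty power_not_zero zero_neq_numeral)
  have rt: "random_tournament U = map_pmf (\<lambda>\<omega>. \<omega> ` ?P) (pmf_of_set ?D)"
    unfolding random_tournament_def Let_def orientations_def[symmetric]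
    using Pi_pmf_of_set[OF fin, of orientations] ori by simp
  \<comment> \<open>The chosen pair determines the edge it orients. Hence an element of the image of
    \<open>\<omega>\<close> reveals where it came from, which yields injectivity.\<close>
  have mem: "{fst (\<omega> e), snd (\<omega> e)} = e" if "\<omega> \<in> ?D" "e \<in> ?P" for \<omega> e
  proof -
    have "\<omega> e \<in> orientations e" using that unfolding PiE_dflt_def by blast
    then show ?thesis by (auto simp: orientations_def)
  qed
  have "inj_on (\<lambda>\<omega>. \<omega> ` ?P) ?D"
  proof (rule inj_onI, rule ext)
    fix \<omega> \<omega>' e assume *: "\<omega> \<in> ?D" "\<omega>' \<in> ?D" "\<omega> ` ?P = \<omega>' ` ?P"
    show "\<omega> e = \<omega>' e"
    proof (cases "e \<in> ?P")
      case True
      then have "\<omega> e \<in> \<omega>' ` ?P" using *(3) by blast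
      then obtain e' where e': "e' \<in> ?P" "\<omega> e = \<omega>' e'" by blast
      then have "e' = e" using mem[OF *(1) True] mem[OF *(2) e'(1)] by simp
      then show ?thesis using e' by simp
    next
      case False
      then show ?thesis using *(1,2) unfolding PiE_dflt_def by auto
    qed
  qed
  moreover have "(\<lambda>\<omega>. \<omega> ` ?P) ` ?D = tournaments U"
  proof
    show "(\<lambda>\<omega>. \<omega> ` ?P) ` ?D \<subseteq> tournaments U"
      \<comment> \<open>The support of the random tournament is exactly this image, so the inclusion
        is the known bound on the support.\<close>
      using set_pmf_random_tournament[OF assms] by (simp add: rt set_pmf_of_set[OF D finD])
    show "tournaments U \<subseteq> (\<lambda>\<omega>. \<omega> ` ?P) ` ?D"
    proof
      fix T assume T: "T \<in> tournaments U"
      \<comment> \<open>The preimage of \<open>T\<close> picks the orientation of each pair that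
        occurs in \<open>T\<close>. The value \<open>undefined\<close> off \<open>?P\<close> is the
        default required by \<open>PiE_dflt\<close>.\<close>
      define \<omega> where "\<omega> e = (if e \<in> ?P then SOME p. p \<in> T \<inter> orientations e else undefined)" for e
      have "\<exists>p. p \<in> T \<inter> orientations e" if "e \<in> ?P" for e
      proof -
        obtain a b where ab: "e = {a, b}" "a \<noteq> b" using \<open>e \<in> ?P\<close> by (auto simp: card_2_iff)
        then have "(a, b) \<in> T \<or> (b, a) \<in> T"
          using tournaments_total[OF T, of a b] \<open>e \<in> ?P\<close> by auto
        then show ?thesis using ab by (auto simp: orientations_def insert_commute)
      qed
      then have \<omega>: "\<omega> e \<in> T \<inter> orientations e" if "e \<in> ?P" for e
        unfolding \<omega>_def using that someI_ex[of "\<lambda>p. p \<in> T \<inter> orientations e"] by auto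
      then have "\<omega> \<in> ?D" unfolding PiE_dflt_def by (auto simp: \<omega>_def)
      moreover have "\<omega> ` ?P = T"
      proof
        show "\<omega> ` ?P \<subseteq> T" using \<omega> by blast
        show "T \<subseteq> \<omega> ` ?P"
        proof
          fix p assume "p \<in> T"
          obtain x y where p: "p = (x, y)" by fastforce
          have xy: "x \<noteq> y" "x \<in> U" "y \<in> U"
            using \<open>p \<in> T\<close> tournaments_subset[OF T] tournaments_irrefl[OF T] unfolding p by auto
          then have P: "{x, y} \<in> ?P" by simp
          have "\<omega> {x, y} = (x, y)"
            using \<omega>[OF P] tournaments_total[OF T xy(2,3,1)] \<open>p \<in> T\<close> unfolding p
            by (auto simp: orientations_def doubleton_eq_iff)
          then show "p \<in> \<omega> ` ?P" using P unfolding p by (metis imageI)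
        qed
      qed
      ultimately show "T \<in> (\<lambda>\<omega>. \<omega> ` ?P) ` ?D" by blast
    qed
  qed
  ultimately have bij: "bij_betw (\<lambda>\<omega>. \<omega> ` ?P) ?D (tournaments U)" by (simp add: bij_betw_def)
  show "random_tournament U = pmf_of_set (tournaments U)"
    unfolding rt by (rule map_pmf_of_set_bij_betw[OF bij D finD])
  show "card (tournaments U) = 2 ^ (card U choose 2)"
    using bij_betw_same_card[OF bij] cardD by simp
qed

section \<open>Restriction of a uniform tournament to a vertex subset\<close>

lemma induced_tournament:
  assumes R: "R \<in> tournaments U" and W: "W \<subseteq> U"
  shows "induced R W \<in> tournaments W"
proof (rule tournamentsI)
  fix x y assume "x \<in> W" "y \<in> W" "x \<noteq> y"
  then show "(x, y) \<in> induced R W \<longleftrightarrow> (y, x) \<notin> induced R W"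
    using tournaments_total[OF R, of x y] W by (auto simp: induced_def)
qed (use tournaments_irrefl[OF R] in \<open>auto simp: induced_def\<close>)

text \<open>Restricting a uniform tournament to \<open>W\<close> gives a uniform tournament, because the edges
  inside \<open>W\<close> and the remaining ones can be chosen independently.\<close>

lemma card_induced:
  assumes "finite U" "W \<subseteq> U" "A \<subseteq> tournaments W"
  shows "card {R \<in> tournaments U. induced R W \<in> A} * card (tournaments W)
    = card A * card (tournaments U)"
proof -
  \<comment> \<open>The possible choices for the edges not inside \<open>W\<close>. Its size is a
    common factor in both counts below, so no formula for it is required.\<close>
  define E where "E = (\<lambda>R. R - W \<times> W) ` tournaments U"
  \<comment> \<open>Any tournament on \<open>W\<close> is compatible with any choice of the other
    edges; this is the independence behind the product decomposition.\<close>
  have glue: "S \<union> (R - W \<times> W) \<in> tournaments U"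
    if S: "S \<in> tournaments W" and R: "R \<in> tournaments U" for S R
  proof (rule tournamentsI)
    show "S \<union> (R - W \<times> W) \<subseteq> U \<times> U"
      using tournaments_subset[OF S] tournaments_subset[OF R] assms(2) by blast
    show "(x, x) \<notin> S \<union> (R - W \<times> W)" for x
      using tournaments_irrefl[OF S] tournaments_irrefl[OF R] by blast
    fix x y assume xy: "x \<in> U" "y \<in> U" "x \<noteq> y"
    show "(x, y) \<in> S \<union> (R - W \<times> W) \<longleftrightarrow> (y, x) \<notin> S \<union> (R - W \<times> W)"
    proof (cases "x \<in> W \<and> y \<in> W")
      case True
      then show ?thesis using tournaments_total[OF S, of x y] xy by auto
    next
      case False
      then show ?thesis
        using tournaments_total[OF R xy] tournaments_subset[OF S] by auto
    qed
  qed
  have split: "card {R \<in> tournaments U. induced R W \<in> B} = card B * card E"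
    if B: "B \<subseteq> tournaments W" for B
  proof -
    have sub: "S \<subseteq> W \<times> W" if "S \<in> B" for S using that B tournaments_subset by blast
    have glued: "induced (S \<union> (R - W \<times> W)) W = S" "S \<union> (R - W \<times> W) - W \<times> W = R - W \<times> W"
      if "S \<in> B" for S R
      using sub[OF that] unfolding induced_def by blast+
    have "bij_betw (\<lambda>R. (induced R W, R - W \<times> W)) {R \<in> tournaments U. induced R W \<in> B} (B \<times> E)"
    proof (rule bij_betw_byWitness[where f' = "\<lambda>(S, Q). S \<union> Q"])
      show "\<forall>p\<in>B \<times> E. (\<lambda>R. (induced R W, R - W \<times> W)) ((\<lambda>(S, Q). S \<union> Q) p) = p"
        unfolding E_def using glued by auto
      show "(\<lambda>R. (induced R W, R - W \<times> W)) ` {R \<in> tournaments U. induced R W \<in> B} \<subseteq> B \<times> E"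
        unfolding E_def by auto
      show "(\<lambda>(S, Q). S \<union> Q) ` (B \<times> E) \<subseteq> {R \<in> tournaments U. induced R W \<in> B}"
        unfolding E_def using glue glued(1) B by auto
    qed (auto simp: induced_def)
    then show ?thesis by (simp add: bij_betw_same_card card_cartesian_product)
  qed
  have "{R \<in> tournaments U. induced R W \<in> tournaments W} = tournaments U"
    using induced_tournament[OF _ assms(2)] by blast
  then have "card (tournaments U) = card (tournaments W) * card E"
    using split[of "tournaments W"] by simp
  then show ?thesis using split[OF assms(3)] by simp
qed

section \<open>Switching classes\<close>

text \<open>When \<open>v\<close> lies outside the switching set, the edge between \<open>v\<close>
  and \<open>x\<close> is reversed iff \<open>x\<close> belongs to that set, so the edges at
  \<open>v\<close> recover the set. Fixing \<open>v\<close> selects one set from each complementary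
  pair.\<close>

lemma switch_inject:
  assumes T: "T \<in> tournaments V" and X: "X \<subseteq> V" "Y \<subseteq> V" and v: "v \<in> V" "v \<notin> X" "v \<notin> Y"
    and eq: "switch X T = switch Y T"
  shows "X = Y"
proof -
  have "x \<in> X \<longleftrightarrow> x \<in> Y" if "x \<in> V" for x
  proof (cases "x = v")
    case False
    have "(v, x) \<in> switch X T \<longleftrightarrow> (v, x) \<in> switch Y T" by (simp add: eq)
    then show ?thesis
      using tournaments_total[OF T v(1) that] False v by (auto simp: switch_def split: if_splits)
  qed (use v in auto)
  then show ?thesis using X by blast
qed

lemma switch_tournament:
  assumes T: "T \<in> tournaments V"
  shows "switch X T \<in> tournaments V"
proof (rule tournamentsI)
  show "switch X T \<subseteq> V \<times> V"
    using tournaments_subset[OF T] by (auto simp: switch_def split: if_splits)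
  show "(x, x) \<notin> switch X T" for x
    using tournaments_irrefl[OF T] by (simp add: switch_def)
  fix x y assume "x \<in> V" "y \<in> V" "x \<noteq> y"
  then show "(x, y) \<in> switch X T \<longleftrightarrow> (y, x) \<notin> switch X T"
    using tournaments_total[OF T, of x y] by (auto simp: switch_def)
qed

lemma switch_complement:
  "T \<subseteq> V \<times> V \<Longrightarrow> switch (V - X) T = switch X T"
  by (auto simp: switch_def split: if_splits)

text \<open>Complementary sets switch alike, so sets avoiding a fixed vertex \<open>v\<close> reach
  the whole class. Distinct such sets give distinct tournaments, so the class is in bijection with
  the subsets of \<open>V - {v}\<close>.\<close>

lemma card_switching_class:
  assumes "finite V" "C \<in> switching_classes V"
  shows "card C = 2 ^ (card V - 1)"
proof -
  obtain T where T: "T \<in> tournaments V" and C: "C = switching V `` {T}"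
    using assms(2) by (auto simp: switching_classes_def elim: quotientE)
  have CX: "C = (\<lambda>X. switch X T) ` Pow V"
    unfolding C using T switch_tournament[OF T] by (auto simp: switching_def)
  show ?thesis
  proof (cases "V = {}")
    \<comment> \<open>Truncated subtraction makes the exponent 0 here, in agreement with the single
      member of the class.\<close>
    case True
    then show ?thesis by (simp add: CX)
  next
    case False
    then obtain v where v: "v \<in> V" by blast
    have "C = (\<lambda>X. switch X T) ` Pow (V - {v})"
    proof
      show "C \<subseteq> (\<lambda>X. switch X T) ` Pow (V - {v})"
      proof
        fix S assume "S \<in> C"
        then obtain X where X: "X \<subseteq> V" "S = switch X T" by (auto simp: CX)
        show "S \<in> (\<lambda>X. switch X T) ` Pow (V - {v})"
        proof (cases "v \<in> X")
          case True
          then have "V - X \<in> Pow (V - {v})" "S = switch (V - X) T"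
            using X switch_complement[OF tournaments_subset[OF T]] by auto
          then show ?thesis by blast
        next
          case False
          then show ?thesis using X by blast
        qed
      qed
    qed (auto simp: CX)
    moreover have "inj_on (\<lambda>X. switch X T) (Pow (V - {v}))"
      by (rule inj_onI) (rule switch_inject[OF T _ _ v], auto)
    ultimately show ?thesis
      using assms(1) v by (simp add: card_image card_Pow)
  qed
qed

text \<open>Conversely to \<open>tourn_triple_switching\<close>, fix a vertex \<open>v\<close> and switch at
  the vertices whose edge to \<open>v\<close> is oriented differently in the two tournaments.\<close>

lemma switching_iff_tourn_triple:
  assumes S: "S \<in> tournaments V" and T: "T \<in> tournaments V"
  shows "(S, T) \<in> switching V \<longleftrightarrow>
    (\<forall>x\<in>V. \<forall>y\<in>V. \<forall>z\<in>V. distinct [x, y, z] \<longrightarrow> tourn_triple T x y z = tourn_triple S x y z)"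
    (is "_ \<longleftrightarrow> ?inv")
proof
  assume "(S, T) \<in> switching V"
  then show ?inv using tourn_triple_switching by fastforce
next
  assume inv: ?inv
  show "(S, T) \<in> switching V"
  proof (cases "V = {}")
    case True
    then show ?thesis using S T by (auto simp: tournaments_def switching_def switch_def)
  next
    case False
    then obtain v where v: "v \<in> V" by blast
    define X where "X = {x \<in> V - {v}. \<not> ((v, x) \<in> S \<longleftrightarrow> (v, x) \<in> T)}"
    have X: "x \<in> X \<longleftrightarrow> \<not> ((v, x) \<in> S \<longleftrightarrow> (v, x) \<in> T)" if "x \<in> V" "x \<noteq> v" for x
      using that by (simp add: X_def)
    have vX: "v \<notin> X" by (simp add: X_def)
    have "T = switch X S"
    proof (rule tournaments_eqI[OF T switch_tournament[OF S]])
      fix x y assume xy: "x \<in> V" "y \<in> V" "x \<noteq> y"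
      note tot = tournaments_total[OF S] tournaments_total[OF T]
      consider "x = v" | "y = v" | "x \<noteq> v" "y \<noteq> v" by blast
      then show "(x, y) \<in> T \<longleftrightarrow> (x, y) \<in> switch X S"
      proof cases
        case 1
        then show ?thesis using X[of y] vX xy tot[of v y] by (auto simp: switch_def)
      next
        case 2
        then show ?thesis using X[of x] vX xy tot[of v x] by (auto simp: switch_def)
      next
        case 3
        \<comment> \<open>The edges from \<open>v\<close> to \<open>x\<close> and to
          \<open>y\<close> differ between \<open>S\<close> and \<open>T\<close> iff the other end is
          in \<open>X\<close>. Equal triple products then force the edge \<open>xy\<close> to be
          reversed iff exactly one of \<open>x\<close>, \<open>y\<close> is in
          \<open>X\<close>.\<close>
        then have "tourn_triple T v x y = tourn_triple S v x y" using inv v xy by auto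
        then show ?thesis
          using X[of x] X[of y] 3 xy tot[of v x] tot[of v y] tot[of x y] v
          by (auto simp: switch_def tourn_triple_def tourn_sign_def split: if_splits)
      qed
    qed
    moreover have "X \<subseteq> V" by (auto simp: X_def)
    ultimately show ?thesis using S T by (auto simp: switching_def)
  qed
qed

section \<open>Relabelling\<close>

text \<open>Relabelling contravariantly avoids inverses of \<open>f\<close> and cuts down to
  \<open>V\<close> at once. Composition is reversed, so the permutations of \<open>V\<close> act
  from the right, which is why right cosets occur later.\<close>

definition pullback :: "'a set \<Rightarrow> ('a \<Rightarrow> 'b) \<Rightarrow> ('b \<times> 'b) set \<Rightarrow> ('a \<times> 'a) set" where
  "pullback V f S = {(x, y). x \<in> V \<and> y \<in> V \<and> (f x, f y) \<in> S}"

lemma pullback_tournament: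
  assumes f: "inj_on f V" "f ` V \<subseteq> W" and T: "T \<in> tournaments W"
  shows "pullback V f T \<in> tournaments V"
proof (rule tournamentsI)
  fix x y assume xy: "x \<in> V" "y \<in> V" "x \<noteq> y"
  then have "f x \<in> W" "f y \<in> W" "f x \<noteq> f y" using f by (auto simp: inj_on_eq_iff)
  then show "(x, y) \<in> pullback V f T \<longleftrightarrow> (y, x) \<notin> pullback V f T"
    using tournaments_total[OF T, of "f x" "f y"] xy by (simp add: pullback_def)
qed (use tournaments_irrefl[OF T] in \<open>auto simp: pullback_def\<close>)

lemma pullback_pullback:
  "f ` V \<subseteq> W \<Longrightarrow> pullback V f (pullback W g T) = pullback V (\<lambda>x. g (f x)) T"
  by (auto simp: pullback_def)

lemma pullback_id:
  "T \<subseteq> V \<times> V \<Longrightarrow> (\<And>x. x \<in> V \<Longrightarrow> f x = x) \<Longrightarrow> pullback V f T = T"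
  by (auto simp: pullback_def)

lemma pullback_inv_into:
  assumes h: "bij_betw h V W" and T: "T \<subseteq> W \<times> W"
  shows "pullback W (inv_into V h) (pullback V h T) = T"
proof -
  have "inv_into V h ` W \<subseteq> V" using bij_betw_inv_into[OF h] by (simp add: bij_betw_def)
  then show ?thesis
    by (simp add: pullback_pullback) (rule pullback_id[OF T bij_betw_inv_into_right[OF h]])
qed

lemma tourn_triple_pullback:
  assumes "x \<in> V" "y \<in> V" "z \<in> V"
  shows "tourn_triple (pullback V f T) x y z = tourn_triple T (f x) (f y) (f z)"
  using assms by (simp add: tourn_triple_def tourn_sign_def pullback_def)

lemma tourn_iso_iff_pullback:
  assumes "T \<subseteq> V \<times> V"
  shows "tourn_iso V T W S \<longleftrightarrow> (\<exists>f. bij_betw f V W \<and> T = pullback V f S)"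
proof -
  have "(\<forall>x\<in>V. \<forall>y\<in>V. (x, y) \<in> T \<longleftrightarrow> (f x, f y) \<in> S) \<longleftrightarrow> T = pullback V f S" for f
    using assms by (auto simp: pullback_def)
  then show ?thesis by (simp add: tourn_iso_def)
qed

section \<open>The action of the symmetric group on switching classes\<close>

lemma carrier_BijGroup: "carrier (BijGroup V) = Bij V"
  by (simp add: BijGroup_def)

lemma Bij_imp_bij_betw: "f \<in> Bij V \<Longrightarrow> bij_betw f V V"
  by (simp add: Bij_def)

text \<open>The value of \<open>f\<close> determines that of \<open>g\<close> and conversely, so
  sending \<open>f x\<close> to \<open>g x\<close> is a well-defined bijection of the images. It
  serves to match images of a class with cosets.\<close>

lemma card_image_eq_if_same_kernel:
  assumes "\<And>x y. x \<in> A \<Longrightarrow> y \<in> A \<Longrightarrow> f x = f y \<longleftrightarrow> g x = g y"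
  shows "card (f ` A) = card (g ` A)"
proof -
  define k where "k u = g (inv_into A f u)" for u
  have k: "k (f x) = g x" if "x \<in> A" for x
    using assms[of "inv_into A f (f x)" x] that
    by (simp add: k_def f_inv_into_f inv_into_into)
  then have "bij_betw k (f ` A) (g ` A)"
    using assms by (auto simp: bij_betw_def inj_on_def image_image)
  then show ?thesis by (rule bij_betw_same_card)
qed

context
  fixes V :: "'a set" and C :: "('a \<times> 'a) set set" and T :: "('a \<times> 'a) set"
  assumes T: "T \<in> tournaments V" and C: "C = switching V `` {T}"
begin

text \<open>The triple function is a complete invariant of switching, so the class of
  \<open>T\<close> is cut out by it.\<close>

lemma mem_class_iff:
  "S \<in> C \<longleftrightarrow> S \<in> tournaments V \<and>
    (\<forall>x\<in>V. \<forall>y\<in>V. \<forall>z\<in>V. distinct [x, y, z] \<longrightarrow> tourn_triple S x y z = tourn_triple T x y z)"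
proof -
  have "S \<in> C \<Longrightarrow> S \<in> tournaments V" by (auto simp: C switching_def)
  then show ?thesis using switching_iff_tourn_triple[OF T, of S] by (auto simp: C)
qed

text \<open>All members of \<open>C\<close> have the same triple function on distinct vertices, and
  a bijection keeps vertices distinct, so invariance can be tested on \<open>T\<close>
  alone.\<close>

lemma class_aut_iff:
  "\<sigma> \<in> class_aut V C \<longleftrightarrow> \<sigma> \<in> Bij V \<and>
    (\<forall>x\<in>V. \<forall>y\<in>V. \<forall>z\<in>V. distinct [x, y, z] \<longrightarrow>
      tourn_triple T (\<sigma> x) (\<sigma> y) (\<sigma> z) = tourn_triple T x y z)" (is "_ \<longleftrightarrow> _ \<and> ?inv")
proof (cases "\<sigma> \<in> Bij V")
  case B: True
  have TC: "T \<in> C" using T by (simp add: mem_class_iff)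
  show ?thesis
  proof
    assume "\<sigma> \<in> class_aut V C"
    then show "\<sigma> \<in> Bij V \<and> ?inv" using TC B unfolding class_aut_def by blast
  next
    assume inv: "\<sigma> \<in> Bij V \<and> ?inv"
    have "tourn_triple S (\<sigma> x) (\<sigma> y) (\<sigma> z) = tourn_triple S x y z"
      if S: "S \<in> C" and *: "x \<in> V" "y \<in> V" "z \<in> V" "distinct [x, y, z]" for S x y z
    proof -
      have "\<sigma> x \<in> V" "\<sigma> y \<in> V" "\<sigma> z \<in> V" "distinct [\<sigma> x, \<sigma> y, \<sigma> z]"
        using Bij_imp_bij_betw[OF B] * by (auto simp: bij_betw_def inj_on_eq_iff)
      then have "tourn_triple S (\<sigma> x) (\<sigma> y) (\<sigma> z) = tourn_triple T (\<sigma> x) (\<sigma> y) (\<sigma> z)"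
        using S mem_class_iff by blast
      also have "\<dots> = tourn_triple T x y z" using inv * by blast
      also have "\<dots> = tourn_triple S x y z" using S * mem_class_iff by metis
      finally show ?thesis .
    qed
    then show "\<sigma> \<in> class_aut V C" using B by (simp add: class_aut_def carrier_BijGroup)
  qed
qed (simp add: class_aut_def carrier_BijGroup)

text \<open>Relabelling carries the triple function along, and that function determines the class.
  Surjectivity comes from relabelling by the inverse permutation.\<close>

lemma pullback_class:
  assumes \<sigma>: "\<sigma> \<in> Bij V"
  shows "pullback V \<sigma> ` C = switching V `` {pullback V \<sigma> T}"
proof -
  have b: "bij_betw \<sigma> V V" by (rule Bij_imp_bij_betw[OF \<sigma>])
  define \<tau> where "\<tau> = inv_into V \<sigma>"
  have bt: "bij_betw \<tau> V V" unfolding \<tau>_def by (rule bij_betw_inv_into[OF b])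
  have \<sigma>\<tau>: "\<sigma> (\<tau> x) = x" and \<tau>\<sigma>: "\<tau> (\<sigma> x) = x" if "x \<in> V" for x
    using b that by (simp_all add: \<tau>_def bij_betw_inv_into_right bij_betw_inv_into_left)
  have pull: "pullback V f S \<in> tournaments V"
    if "bij_betw f V V" "S \<in> tournaments V" for f S
    using pullback_tournament[of f V V S] that by (auto simp: bij_betw_def)
  have dist: "f x \<in> V \<and> f y \<in> V \<and> f z \<in> V \<and> distinct [f x, f y, f z]"
    if "bij_betw f V V" "x \<in> V" "y \<in> V" "z \<in> V" "distinct [x, y, z]" for f x y z
    using that by (auto simp: bij_betw_def inj_on_eq_iff)
  have sw: "S \<in> switching V `` {pullback V \<sigma> T} \<longleftrightarrow> S \<in> tournaments V \<and>
    (\<forall>x\<in>V. \<forall>y\<in>V. \<forall>z\<in>V. distinct [x, y, z] \<longrightarrow>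
      tourn_triple S x y z = tourn_triple T (\<sigma> x) (\<sigma> y) (\<sigma> z))" for S
  proof -
    have "S \<in> switching V `` {pullback V \<sigma> T} \<Longrightarrow> S \<in> tournaments V"
      by (auto simp: switching_def)
    then show ?thesis
      using switching_iff_tourn_triple[OF pull[OF b T], of S]
      by (auto simp: tourn_triple_pullback)
  qed
  show ?thesis
  proof
    show "pullback V \<sigma> ` C \<subseteq> switching V `` {pullback V \<sigma> T}"
    proof
      fix S' assume "S' \<in> pullback V \<sigma> ` C"
      then obtain S where S: "S \<in> C" "S' = pullback V \<sigma> S" by blast
      then show "S' \<in> switching V `` {pullback V \<sigma> T}"
        unfolding sw S(2)
        using pull[OF b, of S] mem_class_iff dist[OF b] by (metis tourn_triple_pullback)
    qed
    show "switching V `` {pullback V \<sigma> T} \<subseteq> pullback V \<sigma> ` C"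
    proof
      fix S assume S: "S \<in> switching V `` {pullback V \<sigma> T}"
      have St: "S \<in> tournaments V" using S unfolding sw by blast
      have "pullback V \<tau> S \<in> C"
        unfolding mem_class_iff
      proof (intro conjI ballI impI)
        show "pullback V \<tau> S \<in> tournaments V" by (rule pull[OF bt St])
        fix x y z assume *: "x \<in> V" "y \<in> V" "z \<in> V" "distinct [x, y, z]"
        have "tourn_triple (pullback V \<tau> S) x y z = tourn_triple S (\<tau> x) (\<tau> y) (\<tau> z)"
          using * by (simp add: tourn_triple_pullback)
        also have "\<dots> = tourn_triple T (\<sigma> (\<tau> x)) (\<sigma> (\<tau> y)) (\<sigma> (\<tau> z))"
          using S dist[OF bt *] unfolding sw by blast
        finally show "tourn_triple (pullback V \<tau> S) x y z = tourn_triple T x y z"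
          using * by (simp add: \<sigma>\<tau>)
      qed
      moreover have "pullback V \<sigma> (pullback V \<tau> S) = S"
        using b tournaments_subset[OF St]
        by (simp add: pullback_pullback bij_betw_def pullback_id \<tau>\<sigma>)
      ultimately show "S \<in> pullback V \<sigma> ` C" by (metis imageI)
    qed
  qed
qed

lemma pullback_class_in_classes:
  assumes "\<sigma> \<in> Bij V"
  shows "pullback V \<sigma> ` C \<in> switching_classes V"
proof -
  have "pullback V \<sigma> T \<in> tournaments V"
    using pullback_tournament[OF _ _ T, of \<sigma> V] Bij_imp_bij_betw[OF assms] by (simp add: bij_betw_def)
  then show ?thesis
    unfolding pullback_class[OF assms] switching_classes_def by (rule quotientI)
qed

text \<open>The orbit-stabiliser argument: the two images agree iff the triple function of
  \<open>T\<close> is the same after \<open>\<sigma>\<close> and after \<open>\<tau>\<close>, that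
  is, iff \<sigma> composed with the inverse of \<tau> is an automorphism of the class.\<close>

lemma pullback_class_eq_iff:
  assumes \<sigma>: "\<sigma> \<in> Bij V" and \<tau>: "\<tau> \<in> Bij V"
  shows "pullback V \<sigma> ` C = pullback V \<tau> ` C \<longleftrightarrow>
    class_aut V C #>\<^bsub>BijGroup V\<^esub> \<sigma> = class_aut V C #>\<^bsub>BijGroup V\<^esub> \<tau>"
proof -
  interpret group "BijGroup V" by (rule group_BijGroup)
  interpret H: subgroup "class_aut V C" "BijGroup V" by (rule subgroup_class_aut)
  have b: "bij_betw \<sigma> V V" "bij_betw \<tau> V V" using \<sigma> \<tau> by (simp_all add: Bij_imp_bij_betw)
  have pt: "pullback V \<sigma> T \<in> tournaments V" "pullback V \<tau> T \<in> tournaments V"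
    using pullback_tournament[OF _ _ T, of \<sigma> V] pullback_tournament[OF _ _ T, of \<tau> V] b by (auto simp: bij_betw_def)
  define \<rho> where "\<rho> = \<sigma> \<otimes>\<^bsub>BijGroup V\<^esub> inv\<^bsub>BijGroup V\<^esub> \<tau>"
  have \<rho>B: "\<rho> \<in> Bij V"
    using \<sigma> \<tau> unfolding \<rho>_def carrier_BijGroup[symmetric] by simp
  have "\<rho> = compose V \<sigma> (\<lambda>x\<in>V. inv_into V \<tau> x)"
    unfolding \<rho>_def inv_BijGroup[OF \<tau>]
    using \<sigma> restrict_inv_into_Bij[OF \<tau>] by (simp add: BijGroup_def)
  then have \<rho>: "\<rho> x = \<sigma> (inv_into V \<tau> x)" if "x \<in> V" for x
    using that by (simp add: compose_eq)
  have \<rho>\<tau>: "\<rho> (\<tau> x) = \<sigma> x" if "x \<in> V" for x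
  proof -
    have "\<tau> x \<in> V" using that b(2) by (auto simp: bij_betw_def)
    then show ?thesis using that b(2) by (simp add: \<rho> bij_betw_inv_into_left)
  qed
  have "pullback V \<sigma> ` C = pullback V \<tau> ` C \<longleftrightarrow> (pullback V \<tau> T, pullback V \<sigma> T) \<in> switching V"
    unfolding pullback_class[OF \<sigma>] pullback_class[OF \<tau>]
    using eq_equiv_class_iff[OF equiv_switching pt(2) pt(1)] by auto
  also have "\<dots> \<longleftrightarrow> (\<forall>x\<in>V. \<forall>y\<in>V. \<forall>z\<in>V. distinct [x, y, z] \<longrightarrow>
      tourn_triple T (\<rho> (\<tau> x)) (\<rho> (\<tau> y)) (\<rho> (\<tau> z)) = tourn_triple T (\<tau> x) (\<tau> y) (\<tau> z))"
    using switching_iff_tourn_triple[OF pt(2) pt(1)]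
    by (auto simp: tourn_triple_pullback \<rho>\<tau>)
  \<comment> \<open>Change of variables: since \<open>\<tau>\<close> is a permutation of
    \<open>V\<close>, its values run through all of \<open>V\<close>, and it preserves
    distinctness.\<close>
  also have "\<dots> \<longleftrightarrow> (\<forall>x\<in>\<tau> ` V. \<forall>y\<in>\<tau> ` V. \<forall>z\<in>\<tau> ` V. distinct [x, y, z] \<longrightarrow>
      tourn_triple T (\<rho> x) (\<rho> y) (\<rho> z) = tourn_triple T x y z)"
  proof -
    have "distinct [\<tau> x, \<tau> y, \<tau> z] \<longleftrightarrow> distinct [x, y, z]" if "x \<in> V" "y \<in> V" "z \<in> V" for x y z
      using inj_on_eq_iff[OF bij_betw_imp_inj_on[OF b(2)]] that by simp
    then show ?thesis by simp
  qed
  also have "\<dots> \<longleftrightarrow> \<rho> \<in> class_aut V C"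
    using b(2) \<rho>B by (simp add: class_aut_iff bij_betw_def)
  also have "\<dots> \<longleftrightarrow> \<sigma> \<in> class_aut V C #>\<^bsub>BijGroup V\<^esub> \<tau>"
    using H.rcos_module[OF is_group, of \<tau> \<sigma>] \<sigma> \<tau> unfolding \<rho>_def carrier_BijGroup by simp
  also have "\<dots> \<longleftrightarrow> class_aut V C #>\<^bsub>BijGroup V\<^esub> \<sigma> = class_aut V C #>\<^bsub>BijGroup V\<^esub> \<tau>"
    using repr_independence[OF _ _ subgroup_class_aut] rcos_self[OF _ subgroup_class_aut] \<sigma> \<tau>
    unfolding carrier_BijGroup by metis
  finally show ?thesis .
qed

section \<open>Counting the tournaments isomorphic to a member of the class\<close>

lemma card_pullback_classes:
  "card ((\<lambda>\<sigma>. pullback V \<sigma> ` C) ` Bij V) = card (rcosets\<^bsub>BijGroup V\<^esub> (class_aut V C))"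
proof -
  have "rcosets\<^bsub>BijGroup V\<^esub> (class_aut V C)
      = (\<lambda>\<sigma>. class_aut V C #>\<^bsub>BijGroup V\<^esub> \<sigma>) ` Bij V"
    by (auto simp: RCOSETS_def carrier_BijGroup)
  then show ?thesis using card_image_eq_if_same_kernel[of "Bij V", OF pullback_class_eq_iff] by simp
qed

text \<open>The distinct images of \<open>C\<close> are switching classes, hence pairwise disjoint
  and of equal size, and their number is the index of the automorphism group.\<close>

lemma card_Union_pullback_classes:
  assumes fin: "finite V"
  shows "card (\<Union>\<sigma>\<in>Bij V. pullback V \<sigma> ` C)
    = 2 ^ (card V - 1) * card (rcosets\<^bsub>BijGroup V\<^esub> (class_aut V C))"
proof -
  let ?F = "(\<lambda>\<sigma>. pullback V \<sigma> ` C) ` Bij V"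
  have F: "?F \<subseteq> switching_classes V" using pullback_class_in_classes by blast
  have sub: "\<Union>?F \<subseteq> tournaments V"
    using F Union_quotient[OF equiv_switching, of V] unfolding switching_classes_def by blast
  have "2 ^ (card V - 1) * card ?F = card (\<Union>?F)"
  proof (rule card_partition)
    have "?F \<subseteq> Pow (tournaments V)" using sub by blast
    then show "finite ?F" using finite_subset finite_tournaments[OF fin] by blast
    show "finite (\<Union>?F)" using finite_subset[OF sub] finite_tournaments[OF fin] by blast
    show "card c = 2 ^ (card V - 1)" if "c \<in> ?F" for c
      using card_switching_class[OF fin] F that by blast
    show "c1 \<inter> c2 = {}" if "c1 \<in> ?F" "c2 \<in> ?F" "c1 \<noteq> c2" for c1 c2
      using quotient_disj[OF equiv_switching, of c1 V c2] F that
      unfolding switching_classes_def by blast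
  qed
  then show ?thesis by (simp add: card_pullback_classes)
qed

text \<open>Pulling back along one fixed bijection \<open>h\<close> from \<open>W\<close> to
  \<open>V\<close> transports the count on \<open>V\<close> to \<open>W\<close>; every isomorphism
  differs from the inverse of \<open>h\<close> by a permutation of \<open>V\<close>.\<close>

lemma card_isomorphic_to_class:
  fixes W :: "'b set"
  assumes fin: "finite V" and W: "finite W" "card W = card V"
  shows "card {S \<in> tournaments W. \<exists>T'\<in>C. tourn_iso V T' W S}
    = 2 ^ (card V - 1) * card (rcosets\<^bsub>BijGroup V\<^esub> (class_aut V C))"
proof -
  obtain h where h: "bij_betw h W V"
    using finite_same_card_bij[OF W(1) fin W(2)] by blast
  let ?O = "\<Union>\<sigma>\<in>Bij V. pullback V \<sigma> ` C"
  let ?A = "{S \<in> tournaments W. \<exists>T'\<in>C. tourn_iso V T' W S}"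
  let ?k = "inv_into W h"
  have k: "bij_betw ?k V W" by (rule bij_betw_inv_into[OF h])
  have CV: "S \<in> tournaments V" if "S \<in> C" for S using that mem_class_iff by blast
  have "?A = pullback W h ` ?O"
  proof
    show "?A \<subseteq> pullback W h ` ?O"
    proof
      fix S assume "S \<in> ?A"
      then obtain T' where S: "S \<in> tournaments W" and T': "T' \<in> C" "tourn_iso V T' W S" by blast
      obtain f where f: "bij_betw f V W" "T' = pullback V f S"
        using T' tourn_iso_iff_pullback[OF tournaments_subset[OF CV[OF T'(1)]]] by blast
      \<comment> \<open>Chosen so that following \<open>h\<close> by \<open>?\<sigma>\<close> gives
        the inverse of \<open>f\<close> on \<open>W\<close>. The restriction is there because
        elements of \<open>Bij V\<close> are extensional.\<close>
      let ?\<sigma> = "restrict (\<lambda>x. inv_into V f (?k x)) V"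
      have g: "bij_betw (inv_into V f) W V" by (rule bij_betw_inv_into[OF f(1)])
      have "bij_betw (inv_into V f \<circ> ?k) V V" by (rule bij_betw_trans[OF k g])
      then have \<sigma>: "?\<sigma> \<in> Bij V"
        by (auto simp: Bij_def o_def cong: bij_betw_cong)
      have "pullback W h (pullback V ?\<sigma> T') = pullback W (\<lambda>x. ?\<sigma> (h x)) T'"
        using h by (simp add: pullback_pullback bij_betw_def)
      also have "\<dots> = pullback W (inv_into V f) T'"
        using bij_betw_inv_into_left[OF h] bij_betw_apply[OF h] by (auto simp: pullback_def)
      also have "\<dots> = S"
        unfolding f(2) by (rule pullback_inv_into[OF f(1) tournaments_subset[OF S]])
      finally show "S \<in> pullback W h ` ?O" using \<sigma> T'(1) by blast
    qed
    show "pullback W h ` ?O \<subseteq> ?A"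
    proof
      fix S assume "S \<in> pullback W h ` ?O"
      then obtain \<sigma> T' where \<sigma>: "\<sigma> \<in> Bij V" and T': "T' \<in> C"
        and S: "S = pullback W h (pullback V \<sigma> T')" by blast
      have b: "bij_betw (\<sigma> \<circ> h) W V" by (rule bij_betw_trans[OF h Bij_imp_bij_betw[OF \<sigma>]])
      have S': "S = pullback W (\<sigma> \<circ> h) T'"
        unfolding S using h by (simp add: pullback_pullback bij_betw_def o_def)
      have "S \<in> tournaments W"
        unfolding S' using b by (intro pullback_tournament[OF _ _ CV[OF T']]) (auto simp: bij_betw_def)
      \<comment> \<open>An isomorphism must go from \<open>V\<close> to \<open>W\<close>, so the
        witness is the inverse of \<open>\<sigma> \<circ> h\<close>.\<close>
      moreover have "tourn_iso V T' W S"
        unfolding tourn_iso_iff_pullback[OF tournaments_subset[OF CV[OF T']]] S'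
        using pullback_inv_into[OF b tournaments_subset[OF CV[OF T']]] bij_betw_inv_into[OF b]
        by metis
      ultimately show "S \<in> ?A" using T' by blast
    qed
  qed
  moreover have "inj_on (pullback W h) ?O"
  proof (rule inj_on_inverseI)
    fix S assume "S \<in> ?O"
    then have "S \<subseteq> V \<times> V" by (auto simp: pullback_def)
    then show "pullback V ?k (pullback W h S) = S" by (rule pullback_inv_into[OF h])
  qed
  ultimately show ?thesis by (simp only: card_image card_Union_pullback_classes[OF fin])
qed

end

section \<open>The expectation by double counting\<close>

theorem theorem2p15:
  fixes V :: "'a set" and C :: "('a \<times> 'a) set set" and U :: "'b set" and n r :: nat
  assumes "finite V" and "card V = r"
    and "C \<in> switching_classes V"
    and "finite U" and "card U = n" and "n > r"
  shows "measure_pmf.expectation (random_tournament U)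
           (\<lambda>R. real (card {W. W \<subseteq> U \<and> card W = r \<and> (\<exists>T\<in>C. tourn_iso V T W (induced R W))}))
         = real (n choose r) * (real (card (rcosets\<^bsub>BijGroup V\<^esub> (class_aut V C)))
             / 2 ^ ((r - 1) choose 2))"
proof -
  obtain T where T: "T \<in> tournaments V" and C: "C = switching V `` {T}"
    using assms(3) by (auto simp: switching_classes_def elim: quotientE)
  let ?P = "\<lambda>W R. \<exists>T\<in>C. tourn_iso V T W (induced R W)"
  let ?i = "card (rcosets\<^bsub>BijGroup V\<^esub> (class_aut V C))"
  let ?N = "card (tournaments U)"
  let ?Ws = "{W. W \<subseteq> U \<and> card W = r}"
  have N: "?N > 0" by (simp add: random_tournament_uniform(2)[OF assms(4)])
  then have fin: "finite (tournaments U)" "tournaments U \<noteq> {}"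
    by (auto simp: card_gt_0_iff)
  \<comment> \<open>Pascal's rule; for \<open>r = 0\<close> both sides vanish by truncated
    subtraction.\<close>
  have exponent: "r choose 2 = (r - 1) + ((r - 1) choose 2)"
    by (cases r) (simp_all add: numeral_2_eq_2)
  \<comment> \<open>The probability that a fixed \<open>W\<close> qualifies, with denominators
    cleared so that the counting stays in the natural numbers.\<close>
  have single: "card {R \<in> tournaments U. ?P W R} * 2 ^ ((r - 1) choose 2) = ?i * ?N"
    if W: "W \<in> ?Ws" for W
  proof -
    let ?A = "{S \<in> tournaments W. \<exists>T'\<in>C. tourn_iso V T' W S}"
    have finW: "finite W" using W assms(4) finite_subset by blast
    have "{R \<in> tournaments U. ?P W R} = {R \<in> tournaments U. induced R W \<in> ?A}"
      using induced_tournament[of _ U W] W by blast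
    then have "card {R \<in> tournaments U. ?P W R} * 2 ^ (r choose 2) = 2 ^ (r - 1) * ?i * ?N"
      using card_induced[OF assms(4), of W ?A] W finW assms(1,2)
        card_isomorphic_to_class[OF T C assms(1) finW]
      by (simp add: random_tournament_uniform(2)[OF finW])
    then show ?thesis by (simp add: exponent power_add)
  qed
  \<comment> \<open>Counting the pairs of a tournament \<open>R\<close> and a qualifying
    \<open>W\<close> in both orders plays the part of linearity of expectation.\<close>
  have "(\<Sum>R\<in>tournaments U. card {W \<in> ?Ws. ?P W R}) * 2 ^ ((r - 1) choose 2)
      = (\<Sum>W\<in>?Ws. card {R \<in> tournaments U. ?P W R}) * 2 ^ ((r - 1) choose 2)"
    using sum_multicount_gen[of "tournaments U" ?Ws "\<lambda>R W. ?P W R"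
        "\<lambda>W. card {R \<in> tournaments U. ?P W R}"] fin assms(4) by simp
  also have "\<dots> = (\<Sum>W\<in>?Ws. ?i * ?N)"
    unfolding sum_distrib_right by (rule sum.cong[OF refl single])
  also have "\<dots> = (n choose r) * ?i * ?N"
    using assms(4,5) by (simp add: n_subsets)
  finally have "real ((\<Sum>R\<in>tournaments U. card {W \<in> ?Ws. ?P W R}) * 2 ^ ((r - 1) choose 2))
      = real ((n choose r) * ?i * ?N)" by (rule arg_cong)
  then have count: "(\<Sum>R\<in>tournaments U. real (card {W \<in> ?Ws. ?P W R})) / ?N
      = real (n choose r) * (real ?i / 2 ^ ((r - 1) choose 2))"
    using N by (simp add: field_simps)
  have "{W \<in> ?Ws. ?P W R} = {W. W \<subseteq> U \<and> card W = r \<and> ?P W R}" for R by blast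
  then show ?thesis
    using count
    by (simp add: random_tournament_uniform(1)[OF assms(4)] integral_pmf_of_set[OF fin(2,1)])
qed

end
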